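(* Let $n\ge 3$, let $s_1,\dots,s_n$ be pairwise non-parallel lines through the origin in $\mathbb{R}^2$, and let $t(s_1,\dots,s_n)=k\pi$ (so $1\le k\le n-1$). Then $$\mathbf S_-\cong S^{n-k-2}\times D^{k-1},\qquad \mathbf S_+\cong S^{k-2}\times D^{n-k-1}$$ (homeomorphisms), so $\mathbf S(s_1,\dots,s_n)$ is homeomorphic to $S^{n-k-2}\times D^{k-1}\sqcup S^{k-2}\times D^{n-k-1}$. Here $D^m$ denotes the open $m$-dimensional disc, $D^0$ is a point, and $S^{-1}=\emptyset$.
   Context: For two lines $r,s$ through the origin, $\angle(r,s)$ is the minimal positive angle such that the counterclockwise rotation by $\angle(r,s)$ takes $r$ to $s$, and $t(s_1,\dots,s_n)=\sum_{i=1}^{n-1}\angle(s_i,s_{i+1})+\angle(s_n,s_1)$. For lines $e_1,\dots,e_n$ with $e_i$ parallel to $s_i$, $Q(e_1,\dots,e_n)$ is the closed polygon with consecutive vertices $v_i=e_i\cap e_{i+1}$ (indices mod $n$); $\widetilde{\mathbf S}(s_1,\dots,s_n)$ is the space of such polygons modulo translations. The oriented area of a polygon with vertices $v_i=(x_i,y_i)$ is $\mathcal A=\frac12\sum_i(x_iy_{i+1}-x_{i+1}y_i)$. The configuration space is $\mathbf S(s_1,\dots,s_n)=\{Q\in\widetilde{\mathbf S}:|\mathcal A(Q)|=1\}=\mathbf S_-\sqcup\mathbf S_+$, where $\mathbf S_\pm$ consists of the polygons with $\mathcal A(Q)=\pm1$. *)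

theory Defs
  imports "HOL-Analysis.Analysis"
begin

text \<open>The plane R^2 is modelled by the type complex (x = Re, y = Im).
  Lines through the origin are one-dimensional real subspaces.\<close>

definition line0 :: "complex set \<Rightarrow> bool" where
  "line0 L \<longleftrightarrow> subspace L \<and> dim L = 1"

definition rot :: "real \<Rightarrow> complex \<Rightarrow> complex" where
  "rot \<phi> z = cis \<phi> * z"

definition line_angle :: "complex set \<Rightarrow> complex set \<Rightarrow> real" where
  "line_angle r s = Inf {\<phi>. \<phi> > 0 \<and> rot \<phi> ` r = s}"

definition total_turn :: "nat \<Rightarrow> (nat \<Rightarrow> complex set) \<Rightarrow> real" where
  "total_turn n s = (\<Sum>i<n. line_angle (s i) (s ((i + 1) mod n)))"

text \<open>Closed polygon Q(e_0,...,e_{n-1}) given by its vertex tuple v_i = e_i \<inter> e_{i+1}.\<close>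
definition polygon_of :: "nat \<Rightarrow> (nat \<Rightarrow> complex set) \<Rightarrow> (nat \<Rightarrow> complex)" where
  "polygon_of n e = (\<lambda>i\<in>{..<n}. THE v. v \<in> e i \<inter> e ((i + 1) mod n))"

definition polygons :: "nat \<Rightarrow> (nat \<Rightarrow> complex set) \<Rightarrow> (nat \<Rightarrow> complex) set" where
  "polygons n s = {polygon_of n e | e. \<forall>i<n. \<exists>a. e i = (\<lambda>x. a + x) ` s i}"

definition oriented_area :: "nat \<Rightarrow> (nat \<Rightarrow> complex) \<Rightarrow> real" where
  "oriented_area n v = (1/2) * (\<Sum>i<n. Re (v i) * Im (v ((i + 1) mod n))
                                    - Re (v ((i + 1) mod n)) * Im (v i))"

definition transl_equiv :: "nat \<Rightarrow> (nat \<Rightarrow> complex) \<Rightarrow> (nat \<Rightarrow> complex) \<Rightarrow> bool" where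
  "transl_equiv n v w \<longleftrightarrow> (\<exists>c. \<forall>i<n. w i = v i + c)"

definition quot_class :: "'a topology \<Rightarrow> ('a \<Rightarrow> 'a \<Rightarrow> bool) \<Rightarrow> 'a \<Rightarrow> 'a set" where
  "quot_class X R x = {y \<in> topspace X. R x y}"

definition quotient_top :: "'a topology \<Rightarrow> ('a \<Rightarrow> 'a \<Rightarrow> bool) \<Rightarrow> 'a set topology" where
  "quotient_top X R = topology (\<lambda>U. U \<subseteq> quot_class X R ` topspace X \<and>
        openin X {x \<in> topspace X. quot_class X R x \<in> U})"

lemma istopology_quotient_top:
  "istopology (\<lambda>U. U \<subseteq> quot_class X R ` topspace X \<and>
        openin X {x \<in> topspace X. quot_class X R x \<in> U})"
  unfolding istopology_def
proof (rule conjI; intro allI impI)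
  fix S T :: "'a set set"
  assume a: "S \<subseteq> quot_class X R ` topspace X \<and> openin X {x \<in> topspace X. quot_class X R x \<in> S}"
     and b: "T \<subseteq> quot_class X R ` topspace X \<and> openin X {x \<in> topspace X. quot_class X R x \<in> T}"
  have e: "{x \<in> topspace X. quot_class X R x \<in> S \<inter> T} =
        {x \<in> topspace X. quot_class X R x \<in> S} \<inter> {x \<in> topspace X. quot_class X R x \<in> T}" by blast
  have "openin X {x \<in> topspace X. quot_class X R x \<in> S \<inter> T}"
    unfolding e using a b by (intro openin_Int) simp_all
  moreover have "S \<inter> T \<subseteq> quot_class X R ` topspace X" using a by blast
  ultimately show "S \<inter> T \<subseteq> quot_class X R ` topspace X \<and>
        openin X {x \<in> topspace X. quot_class X R x \<in> S \<inter> T}" by blast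
next
  fix K :: "'a set set set"
  assume a: "\<forall>S\<in>K. S \<subseteq> quot_class X R ` topspace X \<and> openin X {x \<in> topspace X. quot_class X R x \<in> S}"
  have e: "{x \<in> topspace X. quot_class X R x \<in> \<Union>K} = (\<Union>S\<in>K. {x \<in> topspace X. quot_class X R x \<in> S})" by blast
  have "openin X {x \<in> topspace X. quot_class X R x \<in> \<Union>K}"
    unfolding e using a by (intro openin_Union) blast
  moreover have "\<Union>K \<subseteq> quot_class X R ` topspace X" using a by blast
  ultimately show "\<Union>K \<subseteq> quot_class X R ` topspace X \<and> openin X {x \<in> topspace X. quot_class X R x \<in> \<Union>K}"
    by blast
qed

definition polygon_top :: "nat \<Rightarrow> (nat \<Rightarrow> complex set) \<Rightarrow> (nat \<Rightarrow> complex) topology" where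
  "polygon_top n s = subtopology (product_topology (\<lambda>_. euclidean) {..<n}) (polygons n s)"

definition Stilde :: "nat \<Rightarrow> (nat \<Rightarrow> complex set) \<Rightarrow> (nat \<Rightarrow> complex) set topology" where
  "Stilde n s = quotient_top (polygon_top n s) (transl_equiv n)"

text \<open>Classes of polygons with oriented area equal to a (area is translation invariant).\<close>
definition S_area :: "nat \<Rightarrow> (nat \<Rightarrow> complex set) \<Rightarrow> real \<Rightarrow> (nat \<Rightarrow> complex) set topology" where
  "S_area n s a = subtopology (Stilde n s)
      {C \<in> topspace (Stilde n s). \<forall>v\<in>C. oriented_area n v = a}"

definition S_conf :: "nat \<Rightarrow> (nat \<Rightarrow> complex set) \<Rightarrow> (nat \<Rightarrow> complex) set topology" where
  "S_conf n s = subtopology (Stilde n s)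
      {C \<in> topspace (Stilde n s). \<forall>v\<in>C. \<bar>oriented_area n v\<bar> = 1}"

definition sphere_top :: "int \<Rightarrow> (nat \<Rightarrow> real) topology" where
  "sphere_top d = (if d < 0 then trivial_topology else nsphere (nat d))"

definition disc_top :: "nat \<Rightarrow> (nat \<Rightarrow> real) topology" where
  "disc_top m = subtopology (Euclidean_space m) {x. (\<Sum>i<m. x i ^ 2) < 1}"

end

theory Submission
  imports Defs
begin

text \<open>
  Measure the angles \<open>\<beta> i\<close> in \<open>[0, pi)\<close> of the lines from the first one, so that \<open>\<beta> 0 = 0\<close>, and turn
  the plane so that the first line is horizontal. A polygon is determined up to translation by the
  heights \<open>y i\<close> of its vertices above its horizontal side: that side has height 0 at both ends, and
  a side with height difference \<open>h\<close> and slope angle \<open>b\<close> has horizontal extent \<open>h * cot b\<close>. So the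
  polygons modulo translation form \<open>R^(n-2)\<close>, and in these coordinates the area is already diagonal:
  summation by parts in the shoelace formula gives half the sum of
  \<open>(cot (\<beta> (i+1)) - cot (\<beta> i)) * (y i)^2\<close>. A coefficient is positive exactly at a descent
  \<open>\<beta> (i+1) < \<beta> i\<close>, and the total turn is \<open>pi\<close> times the number of cyclic descents, one of which is
  the step back to the first line. So the form has \<open>k - 1\<close> positive and \<open>n - k - 1\<close> negative squares,
  and its level sets are products of a sphere and an open disc.
\<close>

section \<open>Quotients and disjoint sums\<close>

lemma openin_quotient_top:
  "openin (quotient_top X R) U \<longleftrightarrow>
     U \<subseteq> quot_class X R ` topspace X \<and> openin X {x \<in> topspace X. quot_class X R x \<in> U}"
  unfolding quotient_top_def using istopology_quotient_top[of X R] by simp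

lemma topspace_quotient_top: "topspace (quotient_top X R) = quot_class X R ` topspace X"
proof
  have "{x \<in> topspace X. quot_class X R x \<in> quot_class X R ` topspace X} = topspace X"
    by auto
  then show "quot_class X R ` topspace X \<subseteq> topspace (quotient_top X R)"
    by (intro openin_subset) (simp add: openin_quotient_top)
  show "topspace (quotient_top X R) \<subseteq> quot_class X R ` topspace X"
    using openin_quotient_top openin_topspace by blast
qed

lemma quotient_map_quot_class: "quotient_map X (quotient_top X R) (quot_class X R)"
  unfolding quotient_map_def by (auto simp: topspace_quotient_top openin_quotient_top)

lemma homeomorphic_map_quotient_top:
  assumes f: "quotient_map X Y f"
    and fibres: "\<And>x y. x \<in> topspace X \<Longrightarrow> y \<in> topspace X \<Longrightarrow> R x y \<longleftrightarrow> f x = f y"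
  obtains F where "homeomorphic_map (quotient_top X R) Y F"
    and "\<And>x. x \<in> topspace X \<Longrightarrow> F (quot_class X R x) = f x"
proof -
  let ?q = "quot_class X R"
  have "?q x = {y \<in> topspace X. f x = f y}" if "x \<in> topspace X" for x
    using that fibres by (auto simp: quot_class_def)
  then have quot_class_eq_iff: "?q x = ?q y \<longleftrightarrow> f x = f y"
    if "x \<in> topspace X" "y \<in> topspace X" for x y
    using that by auto
  obtain F where cont: "continuous_map (quotient_top X R) Y F"
    and F: "\<And>x. x \<in> topspace X \<Longrightarrow> F (?q x) = f x"
    using quotient_map_lift_exists[OF quotient_map_quot_class[of X R] quotient_imp_continuous_map[OF f]]
      quot_class_eq_iff by metis
  have "quotient_map X Y (F \<circ> ?q)"
    using f by (rule quotient_map_eq) (simp add: F)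
  then have "quotient_map (quotient_top X R) Y F"
    using quotient_map_from_composition quotient_imp_continuous_map[OF quotient_map_quot_class] cont
    by blast
  moreover have "inj_on F (topspace (quotient_top X R))"
    by (auto simp: inj_on_def topspace_quotient_top F quot_class_eq_iff)
  ultimately show thesis
    using that F unfolding homeomorphic_map_def by blast
qed

lemma subtopology_quotient_top_homeomorphic_space:
  assumes f: "quotient_map X Y f"
    and fibres: "\<And>x y. x \<in> topspace X \<Longrightarrow> y \<in> topspace X \<Longrightarrow> R x y \<longleftrightarrow> f x = f y"
    and P: "\<And>x. x \<in> topspace X \<Longrightarrow> P x \<longleftrightarrow> f x \<in> T"
  shows "subtopology (quotient_top X R) {C \<in> topspace (quotient_top X R). \<forall>x\<in>C. P x}
    homeomorphic_space subtopology Y T"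
proof -
  obtain F where hom: "homeomorphic_map (quotient_top X R) Y F"
    and F: "\<And>x. x \<in> topspace X \<Longrightarrow> F (quot_class X R x) = f x"
    using homeomorphic_map_quotient_top[OF f fibres] by blast
  have "F C \<in> T \<longleftrightarrow> (\<forall>x\<in>C. P x)" if "C \<in> topspace (quotient_top X R)" for C
  proof -
    obtain x where x: "x \<in> topspace X" "C = quot_class X R x"
      using \<open>C \<in> _\<close> unfolding topspace_quotient_top by blast
    then have "y \<in> C \<longleftrightarrow> y \<in> topspace X \<and> f x = f y" for y
      using fibres by (auto simp: quot_class_def)
    moreover have "F C = f x"
      using x F by simp
    ultimately show ?thesis
      using x P by metis
  qed
  then show ?thesis
    by (intro homeomorphic_map_imp_homeomorphic_space[OF homeomorphic_map_subtopologies_alt[OF hom]])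
      simp
qed

lemma continuous_map_sum_topology_iff:
  "continuous_map (sum_topology X I) Y f \<longleftrightarrow> (\<forall>i\<in>I. continuous_map (X i) Y (\<lambda>x. f (i, x)))"
proof
  assume "continuous_map (sum_topology X I) Y f"
  then show "\<forall>i\<in>I. continuous_map (X i) Y (\<lambda>x. f (i, x))"
    using continuous_map_compose[OF continuous_map_component_injection] by (fastforce simp: o_def)
next
  assume cont_f: "\<forall>i\<in>I. continuous_map (X i) Y (\<lambda>x. f (i, x))"
  have "{x. (i, x) \<in> {p \<in> topspace (sum_topology X I). f p \<in> U}} = {x \<in> topspace (X i). f (i, x) \<in> U}"
    if "i \<in> I" for i U
    using that by auto
  then show "continuous_map (sum_topology X I) Y f"
    using cont_f unfolding continuous_map_def openin_sum_topology by (auto simp: Pi_iff)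
qed

lemma homeomorphic_space_sum_topology:
  assumes "\<And>i. i \<in> I \<Longrightarrow> X i homeomorphic_space Y i"
  shows "sum_topology X I homeomorphic_space sum_topology Y I"
proof -
  obtain f g where fg: "\<And>i. i \<in> I \<Longrightarrow> homeomorphic_maps (X i) (Y i) (f i) (g i)"
    using assms unfolding homeomorphic_space_def by metis
  have cont_sum: "continuous_map (sum_topology X I) (sum_topology Y I) (\<lambda>(i, x). (i, f i x))"
    if "\<And>i. i \<in> I \<Longrightarrow> continuous_map (X i) (Y i) (f i)"
    for X :: "'a \<Rightarrow> 'd topology" and Y :: "'a \<Rightarrow> 'e topology" and f
    unfolding continuous_map_sum_topology_iff
  proof
    fix i assume "i \<in> I"
    then have "continuous_map (X i) (sum_topology Y I) (Pair i \<circ> f i)"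
      using that continuous_map_component_injection by (intro continuous_map_compose[of _ "Y i"])
    then show "continuous_map (X i) (sum_topology Y I) (\<lambda>x. case (i, x) of (i, x) \<Rightarrow> (i, f i x))"
      by (simp add: o_def)
  qed
  have "homeomorphic_maps (sum_topology X I) (sum_topology Y I)
      (\<lambda>(i, x). (i, f i x)) (\<lambda>(i, y). (i, g i y))"
    using fg unfolding homeomorphic_maps_def by (auto intro!: cont_sum)
  then show ?thesis
    by (rule homeomorphic_maps_imp_homeomorphic_space)
qed

lemma homeomorphic_space_sum_of_open_partition:
  assumes open_U: "\<And>i. i \<in> I \<Longrightarrow> openin X (U i)"
    and cover: "topspace X = (\<Union>i\<in>I. U i)"
    and disj: "disjoint_family_on U I"
  shows "X homeomorphic_space sum_topology (\<lambda>i. subtopology X (U i)) I"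
proof -
  let ?S = "sum_topology (\<lambda>i. subtopology X (U i)) I"
  have topspace_S: "topspace ?S = Sigma I U"
    using open_U openin_subset by fastforce
  have "homeomorphic_map ?S X snd"
  proof (rule bijective_open_imp_homeomorphic_map)
    show "continuous_map ?S X snd"
      by (simp add: continuous_map_sum_topology_iff continuous_map_from_subtopology)
    show "open_map ?S X snd"
      unfolding open_map_def
    proof (intro allI impI)
      fix W assume W: "openin ?S W"
      then have "W \<subseteq> I \<times> UNIV"
        using openin_subset by fastforce
      then have "snd ` W = (\<Union>i\<in>I. {x. (i, x) \<in> W})"
        by (force simp: image_iff)
      moreover have "openin X {x. (i, x) \<in> W}" if "i \<in> I" for i
        using W that open_U by (auto simp: openin_sum_topology intro: openin_trans_full)
      ultimately show "openin X (snd ` W)"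
        by auto
    qed
    show "snd ` topspace ?S = topspace X"
      unfolding topspace_S cover by force
    show "inj_on snd (topspace ?S)"
      using disj unfolding topspace_S by (auto simp: inj_on_def dest: disjoint_family_onD)
  qed
  then show ?thesis
    using homeomorphic_map_imp_homeomorphic_space homeomorphic_space_sym by blast
qed

lemma abs_level_homeomorphic_space_sum:
  assumes cont_f: "continuous_map X euclideanreal f" and "c > 0"
  shows "subtopology X {x. \<bar>f x\<bar> = c} homeomorphic_space
    sum_topology (\<lambda>b. subtopology X {x. f x = (if b then c else - c)}) UNIV"
proof -
  define Z where "Z = subtopology X {x. \<bar>f x\<bar> = c}"
  define U where "U b = {x \<in> topspace Z. f x = (if b then c else - c)}" for b
  have "openin Z (U b)" for b
  proof -
    have "U b = {x \<in> topspace Z. f x \<in> (if b then {0<..} else {..<0})}"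
      using \<open>c > 0\<close> by (auto simp: U_def Z_def abs_if split: if_splits)
    moreover have "continuous_map Z euclideanreal f"
      unfolding Z_def by (rule continuous_map_from_subtopology[OF cont_f])
    ultimately show ?thesis
      by (simp add: openin_continuous_map_preimage)
  qed
  moreover have "topspace Z = (\<Union>b. U b)"
    by (auto simp: U_def Z_def UNIV_bool abs_if split: if_splits)
  moreover have "disjoint_family U"
    using \<open>c > 0\<close> by (auto simp: U_def disjoint_family_on_def split: if_splits)
  ultimately have "Z homeomorphic_space sum_topology (\<lambda>b. subtopology Z (U b)) UNIV"
    by (rule homeomorphic_space_sum_of_open_partition)
  moreover have "subtopology Z (U b) = subtopology X {x. f x = (if b then c else - c)}" for b
  proof -
    have "topspace X \<inter> ({x. \<bar>f x\<bar> = c} \<inter> U b) = topspace X \<inter> {x. f x = (if b then c else - c)}"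
      using \<open>c > 0\<close> by (auto simp: U_def Z_def)
    then show ?thesis
      unfolding Z_def subtopology_subtopology
      using subtopology_restrict[of X "{x. \<bar>f x\<bar> = c} \<inter> U b"]
        subtopology_restrict[of X "{x. f x = (if b then c else - c)}"]
      by simp
  qed
  ultimately show ?thesis
    unfolding Z_def by simp
qed

section \<open>Level sets of diagonal quadratic forms\<close>

definition diag_form :: "('i \<Rightarrow> real) \<Rightarrow> 'i set \<Rightarrow> ('i \<Rightarrow> real) \<Rightarrow> real" where
  "diag_form a I x = (\<Sum>i\<in>I. a i * x i ^ 2)"

abbreviation sqnorm :: "nat \<Rightarrow> (nat \<Rightarrow> real) \<Rightarrow> real" where
  "sqnorm m x \<equiv> \<Sum>k<m. x k ^ 2"

lemma sqnorm_divide: "sqnorm m (\<lambda>k. x k / c) = sqnorm m x / c ^ 2"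
  by (simp add: power_divide sum_divide_distrib)

lemma sphere_top_conv_Euclidean_space:
  "sphere_top (int m - 1) = subtopology (Euclidean_space m) {x. sqnorm m x = 1}"
  by (cases m) (simp_all add: sphere_top_def nsphere_def lessThan_Suc_atMost)

lemma continuous_map_Euclidean_space_projection:
  "continuous_map (Euclidean_space m) euclideanreal (\<lambda>x. x k)"
  unfolding Euclidean_space_def
  by (intro continuous_map_from_subtopology continuous_map_product_projection) simp

lemma continuous_map_Euclidean_space_component:
  assumes "continuous_map X (Euclidean_space m) f"
  shows "continuous_map X euclideanreal (\<lambda>x. f x k)"
  using continuous_map_compose[OF assms continuous_map_Euclidean_space_projection]
  by (simp add: o_def)

lemma continuous_map_sqnorm:
  "continuous_map X (Euclidean_space m) f \<Longrightarrow> continuous_map X euclideanreal (\<lambda>x. sqnorm m (f x))"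
  by (intro continuous_map_sum continuous_map_real_pow continuous_map_Euclidean_space_component) auto

lemma continuous_map_real_sqrt:
  "continuous_map X euclideanreal f \<Longrightarrow> continuous_map X euclideanreal (\<lambda>x. sqrt (f x))"
  by (simp add: continuous_map_atin tendsto_real_sqrt)

lemma continuous_map_Euclidean_space_divide:
  assumes cont_f: "continuous_map X (Euclidean_space m) f" and cont_c: "continuous_map X euclideanreal c"
    and nonzero: "\<And>x. x \<in> topspace X \<Longrightarrow> c x \<noteq> 0"
  shows "continuous_map X (Euclidean_space m) (\<lambda>x k. f x k / c x)"
proof -
  have "continuous_map X (Euclidean_space m) (\<lambda>x k. if k < m then f x k / c x else 0)"
    unfolding continuous_map_componentwise_Euclidean_space
    by (intro allI impI continuous_map_real_divide continuous_map_Euclidean_space_component[OF cont_f]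
        cont_c nonzero)
  moreover have "(if k < m then f x k / c x else 0) = f x k / c x" if "x \<in> topspace X" for x k
    using continuous_map_image_subset_topspace[OF cont_f] that by (auto simp: topspace_Euclidean_space)
  ultimately show ?thesis
    by (elim continuous_map_eq) (simp add: fun_eq_iff)
qed

lemma homeomorphic_map_powertop_Euclidean_space:
  assumes f: "bij_betw f {..<m} I" and nonzero: "\<And>i. i \<in> I \<Longrightarrow> c i \<noteq> 0"
  shows "homeomorphic_map (powertop_real I) (Euclidean_space m)
    (\<lambda>x k. if k < m then c (f k) * x (f k) else 0)"
    (is "homeomorphic_map ?X ?E ?F")
proof -
  define g where "g = inv_into {..<m} f"
  have f_mem: "f k \<in> I" and g_f: "g (f k) = k" if "k < m" for k
    using f that by (auto simp: g_def bij_betw_inv_into_left bij_betw_def)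
  have g_less: "g i < m" and f_g: "f (g i) = i" if "i \<in> I" for i
    using bij_betw_inv_into[OF f] f that by (auto simp: g_def bij_betw_inv_into_right bij_betw_def)
  define G where "G y = (\<lambda>i\<in>I. y (g i) / c i)" for y
  have "continuous_map ?X ?E ?F"
    unfolding continuous_map_componentwise_Euclidean_space
    by (intro allI impI continuous_intros f_mem)
  moreover have "continuous_map ?E euclideanreal (\<lambda>y. y (g i) / c i)" if "i \<in> I" for i
    using nonzero[OF that]
    by (intro continuous_map_real_divide) (auto intro: continuous_map_Euclidean_space_projection)
  then have "continuous_map ?E ?X G"
    by (auto simp: continuous_map_componentwise G_def)
  moreover have "G (?F x) = x" if "x \<in> topspace ?X" for x
    using that nonzero g_less by (auto simp: G_def f_g fun_eq_iff PiE_def extensional_def)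
  moreover have "?F (G y) = y" if "y \<in> topspace ?E" for y
    using that nonzero f_mem by (auto simp: G_def g_f fun_eq_iff topspace_Euclidean_space)
  ultimately show ?thesis
    unfolding homeomorphic_map_maps homeomorphic_maps_def by blast
qed

lemma homeomorphic_map_positive_diag_form:
  assumes "finite I" and pos: "\<And>i. i \<in> I \<Longrightarrow> a i > 0"
  obtains F where "homeomorphic_map (powertop_real I) (Euclidean_space (card I)) F"
    and "\<And>x. sqnorm (card I) (F x) = diag_form a I x"
proof -
  obtain f where f: "bij_betw f {..<card I} I"
    using ex_bij_betw_nat_finite[OF \<open>finite I\<close>] by (auto simp: atLeast0LessThan)
  define F where "F x = (\<lambda>k. if k < card I then sqrt (a (f k)) * x (f k) else 0)" for x
  have "sqrt (a i) \<noteq> 0" if "i \<in> I" for i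
    using pos[OF that] by simp
  then have "homeomorphic_map (powertop_real I) (Euclidean_space (card I)) F"
    unfolding F_def[abs_def] by (rule homeomorphic_map_powertop_Euclidean_space[OF f])
  moreover have "sqnorm (card I) (F x) = diag_form a I x" for x
  proof -
    have "a (f k) > 0" if "k < card I" for k
      using pos f that by (auto simp: bij_betw_def)
    then have "sqnorm (card I) (F x) = (\<Sum>k<card I. a (f k) * x (f k) ^ 2)"
      by (auto simp: F_def power_mult_distrib less_imp_le intro!: sum.cong)
    also have "\<dots> = diag_form a I x"
      unfolding diag_form_def by (rule sum.reindex_bij_betw[OF f])
    finally show ?thesis .
  qed
  ultimately show thesis
    by (rule that)
qed

lemma homeomorphic_map_product_topology_Un:
  assumes "I \<inter> J = {}"
  shows "homeomorphic_map (product_topology X (I \<union> J))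
    (prod_topology (product_topology X I) (product_topology X J)) (\<lambda>x. (restrict x I, restrict x J))"
proof -
  let ?XI = "product_topology X I" and ?XJ = "product_topology X J"
  define G where "G z = (\<lambda>i\<in>I \<union> J. if i \<in> I then fst z i else snd z i)" for z :: "('a \<Rightarrow> 'b) \<times> ('a \<Rightarrow> 'b)"
  have "continuous_map (prod_topology ?XI ?XJ) (X i) (\<lambda>z. G z i)" if "i \<in> I \<union> J" for i
  proof (cases "i \<in> I")
    case True
    from continuous_map_compose[OF continuous_map_fst continuous_map_product_projection[OF this]]
    show ?thesis
      using True by (simp add: G_def o_def)
  next
    case False
    with that have "i \<in> J" by blast
    from continuous_map_compose[OF continuous_map_snd continuous_map_product_projection[OF this]]
    show ?thesis
      using False that by (simp add: G_def o_def)
  qed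
  then have "continuous_map (prod_topology ?XI ?XJ) (product_topology X (I \<union> J)) G"
    by (auto simp: continuous_map_componentwise G_def)
  moreover have "continuous_map (product_topology X (I \<union> J)) (prod_topology ?XI ?XJ)
      (\<lambda>x. (restrict x I, restrict x J))"
    by (intro continuous_map_pairedI) (auto simp: continuous_map_componentwise intro: continuous_intros)
  ultimately have "homeomorphic_maps (product_topology X (I \<union> J)) (prod_topology ?XI ?XJ)
      (\<lambda>x. (restrict x I, restrict x J)) G"
    using assms unfolding homeomorphic_maps_def
    by (auto simp: G_def fun_eq_iff PiE_def extensional_def restrict_def)
  then show ?thesis
    by (rule homeomorphic_maps_imp_map)
qed

lemma homeomorphic_map_diag_form:
  assumes "finite I" and nonzero: "\<And>i. i \<in> I \<Longrightarrow> a i \<noteq> 0"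
  defines "p \<equiv> card {i\<in>I. a i > 0}" and "q \<equiv> card {i\<in>I. a i < 0}"
  obtains F
  where "homeomorphic_map (powertop_real I) (prod_topology (Euclidean_space p) (Euclidean_space q)) F"
    and "\<And>x. diag_form a I x = sqnorm p (fst (F x)) - sqnorm q (snd (F x))"
proof -
  let ?P = "{i\<in>I. a i > 0}" and ?N = "{i\<in>I. a i < 0}"
  have I_eq: "I = ?P \<union> ?N" and disj: "?P \<inter> ?N = {}" and fin: "finite ?P" "finite ?N"
    using \<open>finite I\<close> nonzero by force+
  obtain F where F: "homeomorphic_map (powertop_real ?P) (Euclidean_space p) F"
    and sqnorm_F: "\<And>x. sqnorm p (F x) = diag_form a ?P x"
    using homeomorphic_map_positive_diag_form[OF fin(1), of a] unfolding p_def by auto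
  obtain G where G: "homeomorphic_map (powertop_real ?N) (Euclidean_space q) G"
    and sqnorm_G: "\<And>x. sqnorm q (G x) = diag_form (\<lambda>i. - a i) ?N x"
    using homeomorphic_map_positive_diag_form[OF fin(2), of "\<lambda>i. - a i"] unfolding q_def by auto
  define H where "H x = (F (restrict x ?P), G (restrict x ?N))" for x
  obtain F' G' where "homeomorphic_maps (powertop_real ?P) (Euclidean_space p) F F'"
    "homeomorphic_maps (powertop_real ?N) (Euclidean_space q) G G'"
    using F G unfolding homeomorphic_map_maps by blast
  then have "homeomorphic_map (prod_topology (powertop_real ?P) (powertop_real ?N))
      (prod_topology (Euclidean_space p) (Euclidean_space q)) (\<lambda>(x, y). (F x, G y))"
    using homeomorphic_maps_prod homeomorphic_maps_imp_map by blast
  from homeomorphic_map_compose[OF homeomorphic_map_product_topology_Un[OF disj] this]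
  have "homeomorphic_map (powertop_real I) (prod_topology (Euclidean_space p) (Euclidean_space q)) H"
    unfolding I_eq[symmetric] by (simp add: H_def[abs_def] o_def)
  moreover have "diag_form a I x = sqnorm p (fst (H x)) - sqnorm q (snd (H x))" for x
  proof -
    have "diag_form a I x = diag_form a ?P x + diag_form a ?N x"
      unfolding diag_form_def by (subst I_eq, rule sum.union_disjoint[OF fin disj])
    then show ?thesis
      by (simp add: H_def sqnorm_F sqnorm_G diag_form_def sum_negf)
  qed
  ultimately show thesis
    by (rule that)
qed

definition rescale ::
  "((nat \<Rightarrow> real) \<times> (nat \<Rightarrow> real) \<Rightarrow> real) \<Rightarrow> (nat \<Rightarrow> real) \<times> (nat \<Rightarrow> real) \<Rightarrow> (nat \<Rightarrow> real) \<times> (nat \<Rightarrow> real)"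
  where "rescale c z = (\<lambda>k. fst z k / c z, \<lambda>k. snd z k / c z)"

lemma homeomorphic_maps_rescale:
  fixes p q :: nat
  defines "E \<equiv> prod_topology (Euclidean_space p) (Euclidean_space q)"
  assumes cont_c: "continuous_map E euclideanreal c" and cont_d: "continuous_map E euclideanreal d"
    and S: "\<And>z. z \<in> topspace E \<inter> S \<Longrightarrow> c z > 0 \<and> rescale c z \<in> T \<and> d (rescale c z) = 1 / c z"
    and T: "\<And>z. z \<in> topspace E \<inter> T \<Longrightarrow> d z > 0 \<and> rescale d z \<in> S \<and> c (rescale d z) = 1 / d z"
  shows "homeomorphic_maps (subtopology E S) (subtopology E T) (rescale c) (rescale d)"
proof -
  have cont_rescale: "continuous_map (subtopology E U) (subtopology E V) (rescale b)"
    if cont_b: "continuous_map E euclideanreal b"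
      and pos: "\<And>z. z \<in> topspace E \<inter> U \<Longrightarrow> b z > 0 \<and> rescale b z \<in> V" for U V b
  proof (rule continuous_map_into_subtopology)
    have "continuous_map (subtopology E U) (prod_topology (Euclidean_space p) (Euclidean_space q))
        (\<lambda>z. (\<lambda>k. fst z k / b z, \<lambda>k. snd z k / b z))"
      using cont_b pos unfolding E_def
      by (intro continuous_map_pairedI continuous_map_Euclidean_space_divide
          continuous_map_from_subtopology continuous_map_fst continuous_map_snd) (force simp: E_def)+
    then show "continuous_map (subtopology E U) E (rescale b)"
      by (simp add: E_def rescale_def[abs_def])
  qed (use pos in auto)
  have inverse: "rescale b' (rescale b z) = z" if "b z > 0" "b' (rescale b z) = 1 / b z" for b b' z
    using that by (simp add: rescale_def)
  show ?thesis
    unfolding homeomorphic_maps_def using cont_c cont_d S T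
    by (auto intro!: cont_rescale inverse)
qed

text \<open>The homeomorphism divides \<open>(u, w)\<close> by \<open>|u|\<close>; its inverse divides by \<open>sqrt (1 - |w|^2)\<close>.\<close>

lemma hyperboloid_homeomorphic_sphere_times_disc:
  "subtopology (prod_topology (Euclidean_space p) (Euclidean_space q))
      {z. sqnorm p (fst z) - sqnorm q (snd z) = 1}
    homeomorphic_space prod_topology (sphere_top (int p - 1)) (disc_top q)"
proof -
  let ?E = "prod_topology (Euclidean_space p) (Euclidean_space q)"
  define r where "r z = sqrt (sqnorm p (fst z))" for z :: "(nat \<Rightarrow> real) \<times> (nat \<Rightarrow> real)"
  define d where "d z = sqrt (1 - sqnorm q (snd z))" for z :: "(nat \<Rightarrow> real) \<times> (nat \<Rightarrow> real)"
  have "continuous_map ?E euclideanreal r" "continuous_map ?E euclideanreal d"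
    unfolding r_def d_def
    by (intro continuous_map_real_sqrt continuous_map_diff continuous_map_sqnorm
        continuous_map_fst continuous_map_snd; simp)+
  then have "homeomorphic_maps (subtopology ?E {z. sqnorm p (fst z) - sqnorm q (snd z) = 1})
      (subtopology ?E ({u. sqnorm p u = 1} \<times> {w. sqnorm q w < 1})) (rescale r) (rescale d)"
  proof (rule homeomorphic_maps_rescale)
    fix z assume "z \<in> topspace ?E \<inter> {z. sqnorm p (fst z) - sqnorm q (snd z) = 1}"
    then have p_eq: "sqnorm p (fst z) = 1 + sqnorm q (snd z)"
      by simp
    moreover have "sqnorm q (snd z) \<ge> 0"
      by (rule sum_nonneg) simp
    ultimately have "r z > 0" and q_eq: "sqnorm q (snd z) = r z ^ 2 - 1"
      by (simp_all add: r_def)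
    then show "r z > 0 \<and> rescale r z \<in> {u. sqnorm p u = 1} \<times> {w. sqnorm q w < 1} \<and>
        d (rescale r z) = 1 / r z"
      by (simp add: d_def rescale_def mem_Times_iff sqnorm_divide p_eq q_eq diff_divide_distrib
          real_sqrt_divide)
  next
    fix z assume "z \<in> topspace ?E \<inter> ({u. sqnorm p u = 1} \<times> {w. sqnorm q w < 1})"
    then have p_eq: "sqnorm p (fst z) = 1" and "d z > 0"
      and q_eq: "sqnorm q (snd z) = 1 - d z ^ 2"
      by (auto simp: d_def)
    then show "d z > 0 \<and> rescale d z \<in> {z. sqnorm p (fst z) - sqnorm q (snd z) = 1} \<and>
        r (rescale d z) = 1 / d z"
      by (simp add: r_def rescale_def sqnorm_divide p_eq q_eq diff_divide_distrib real_sqrt_divide)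
  qed
  then show ?thesis
    unfolding disc_top_def sphere_top_conv_Euclidean_space subtopology_Times
    by (rule homeomorphic_maps_imp_homeomorphic_space)
qed

lemma diag_form_uminus: "diag_form (\<lambda>i. - a i) I x = - diag_form a I x"
  by (simp add: diag_form_def sum_negf)

lemma continuous_map_diag_form:
  "finite I \<Longrightarrow> continuous_map (powertop_real I) euclideanreal (diag_form a I)"
  unfolding diag_form_def[abs_def] by (intro continuous_intros) auto

lemma diag_form_level_one_homeomorphic_space:
  assumes "finite I" and "\<And>i. i \<in> I \<Longrightarrow> a i \<noteq> 0"
  shows "subtopology (powertop_real I) {x. diag_form a I x = 1} homeomorphic_space
    prod_topology (sphere_top (int (card {i\<in>I. a i > 0}) - 1)) (disc_top (card {i\<in>I. a i < 0}))"
proof -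
  let ?p = "card {i\<in>I. a i > 0}" and ?q = "card {i\<in>I. a i < 0}"
  obtain F
    where F: "homeomorphic_map (powertop_real I) (prod_topology (Euclidean_space ?p) (Euclidean_space ?q)) F"
      and "\<And>x. diag_form a I x = sqnorm ?p (fst (F x)) - sqnorm ?q (snd (F x))"
    using homeomorphic_map_diag_form[where a = a, OF assms] by blast
  then have "homeomorphic_map (subtopology (powertop_real I) {x. diag_form a I x = 1})
      (subtopology (prod_topology (Euclidean_space ?p) (Euclidean_space ?q))
        {z. sqnorm ?p (fst z) - sqnorm ?q (snd z) = 1}) F"
    by (intro homeomorphic_map_subtopologies_alt) auto
  then show ?thesis
    using hyperboloid_homeomorphic_sphere_times_disc homeomorphic_map_imp_homeomorphic_space
      homeomorphic_space_trans by blast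
qed

lemma diag_form_level_minus_one_homeomorphic_space:
  assumes "finite I" and "\<And>i. i \<in> I \<Longrightarrow> a i \<noteq> 0"
  shows "subtopology (powertop_real I) {x. diag_form a I x = -1} homeomorphic_space
    prod_topology (sphere_top (int (card {i\<in>I. a i < 0}) - 1)) (disc_top (card {i\<in>I. a i > 0}))"
proof -
  have "diag_form a I x = -1 \<longleftrightarrow> diag_form (\<lambda>i. - a i) I x = 1" for x
    unfolding diag_form_uminus by linarith
  then show ?thesis
    using diag_form_level_one_homeomorphic_space[of I "\<lambda>i. - a i"] assms by simp
qed

lemma diag_form_abs_level_one_homeomorphic_space:
  assumes "finite I" and "\<And>i. i \<in> I \<Longrightarrow> a i \<noteq> 0"
  defines "p \<equiv> card {i\<in>I. a i > 0}" and "q \<equiv> card {i\<in>I. a i < 0}"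
  shows "subtopology (powertop_real I) {x. \<bar>diag_form a I x\<bar> = 1} homeomorphic_space
    sum_topology (\<lambda>b. if b then prod_topology (sphere_top (int p - 1)) (disc_top q)
                          else prod_topology (sphere_top (int q - 1)) (disc_top p)) UNIV"
proof -
  have "subtopology (powertop_real I) {x. \<bar>diag_form a I x\<bar> = 1} homeomorphic_space
      sum_topology (\<lambda>b. subtopology (powertop_real I) {x. diag_form a I x = (if b then 1 else - 1)}) UNIV"
    by (rule abs_level_homeomorphic_space_sum[OF continuous_map_diag_form]) (use \<open>finite I\<close> in auto)
  also have "\<dots> homeomorphic_space
    sum_topology (\<lambda>b. if b then prod_topology (sphere_top (int p - 1)) (disc_top q)
                          else prod_topology (sphere_top (int q - 1)) (disc_top p)) UNIV"
    unfolding p_def q_def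
    by (rule homeomorphic_space_sum_topology)
      (use diag_form_level_one_homeomorphic_space[OF assms(1,2)]
          diag_form_level_minus_one_homeomorphic_space[OF assms(1,2)] in auto)
  finally show ?thesis .
qed

section \<open>Lines in the plane\<close>

lemma rot_rot: "rot a (rot b z) = rot (a + b) z"
  by (simp add: rot_def cis_mult flip: mult.assoc)

lemma rot_zero_left [simp]: "rot 0 z = z"
  by (simp add: rot_def)

lemma rot_zero_right [simp]: "rot a 0 = 0"
  by (simp add: rot_def)

lemma rot_diff: "rot a (z - w) = rot a z - rot a w"
  by (simp add: rot_def right_diff_distrib)

lemma rot_scaleR: "rot a (r *\<^sub>R z) = r *\<^sub>R rot a z"
  by (simp add: rot_def)

lemma rot_minus_rot [simp]: "rot (- a) (rot a z) = z"
  by (simp add: rot_rot)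

lemma rot_rot_minus [simp]: "rot a (rot (- a) z) = z"
  by (simp add: rot_rot)

definition line_at :: "real \<Rightarrow> complex set" where
  "line_at \<theta> = {z. Im (rot (- \<theta>) z) = 0}"

lemma line_at_conv_span: "line_at \<theta> = span {cis \<theta>}"
proof -
  have "z \<in> line_at \<theta> \<longleftrightarrow> (\<exists>r. z = r *\<^sub>R cis \<theta>)" for z
  proof
    assume "z \<in> line_at \<theta>"
    then have "rot (- \<theta>) z = of_real (Re (rot (- \<theta>) z))"
      by (simp add: line_at_def complex_eq_iff)
    then have "z = rot \<theta> (of_real (Re (rot (- \<theta>) z)))"
      by (metis rot_rot_minus)
    also have "\<dots> = Re (rot (- \<theta>) z) *\<^sub>R cis \<theta>"
      unfolding rot_def[of \<theta>] by (simp only: scaleR_conv_of_real mult.commute)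
    finally show "\<exists>r. z = r *\<^sub>R cis \<theta>" ..
  next
    assume "\<exists>r. z = r *\<^sub>R cis \<theta>"
    then show "z \<in> line_at \<theta>"
      by (auto simp: line_at_def rot_scaleR) (simp add: rot_def cis_mult)
  qed
  then show ?thesis
    by (auto simp: span_singleton)
qed

lemma line0_line_at: "line0 (line_at \<theta>)"
  by (simp add: line0_def line_at_conv_span dim_singleton)

lemma rot_image_line_at: "rot \<phi> ` line_at \<theta> = line_at (\<theta> + \<phi>)"
proof -
  have "z \<in> rot \<phi> ` line_at \<theta> \<longleftrightarrow> rot (- \<phi>) z \<in> line_at \<theta>" for z
    by (metis image_iff rot_minus_rot rot_rot_minus)
  then show ?thesis
    by (auto simp: line_at_def rot_rot add.commute)
qed

lemma line_at_eq_iff: "line_at \<theta>' = line_at \<theta> \<longleftrightarrow> sin (\<theta>' - \<theta>) = 0"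
proof
  assume "line_at \<theta>' = line_at \<theta>"
  moreover have "cis \<theta>' \<in> line_at \<theta>'"
    by (simp add: line_at_conv_span span_base)
  ultimately have "cis \<theta>' \<in> line_at \<theta>"
    by simp
  then show "sin (\<theta>' - \<theta>) = 0"
    by (simp add: line_at_def rot_def cis_mult sin_diff algebra_simps)
next
  assume sin: "sin (\<theta>' - \<theta>) = 0"
  then have "cos (\<theta>' - \<theta>) \<noteq> 0"
    using sin_cos_squared_add[of "\<theta>' - \<theta>"] by auto
  moreover have "Im (rot (- \<theta>) z) = cos (\<theta>' - \<theta>) * Im (rot (- \<theta>') z)" for z
  proof -
    have "rot (- \<theta>) z = rot (\<theta>' - \<theta>) (rot (- \<theta>') z)"
      by (simp add: rot_rot)
    then show ?thesis
      using sin by (simp add: rot_def[of "\<theta>' - \<theta>"])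
  qed
  ultimately show "line_at \<theta>' = line_at \<theta>"
    by (auto simp: line_at_def)
qed

lemma line_at_add_eq_iff:
  assumes "0 \<le> a" "a < pi" "0 \<le> b" "b < pi"
  shows "line_at (\<theta> + a) = line_at (\<theta> + b) \<longleftrightarrow> a = b"
  using sin_eq_0_pi[of "a - b"] assms by (auto simp: line_at_eq_iff)

lemma line0_eq_line_at:
  assumes "line0 L"
  obtains \<beta> where "0 \<le> \<beta>" "\<beta> < pi" "L = line_at (\<theta> + \<beta>)"
proof -
  have sub: "subspace L" and dim: "dim L = 1"
    using assms by (auto simp: line0_def)
  then obtain b where b: "b \<in> L" "b \<noteq> 0"
    using dim_eq_0[of L] by force
  have "cis (Arg b) \<in> L"
    using b subspace_scale[OF sub b(1), of "inverse (norm b)"]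
    by (simp add: cis_Arg sgn_div_norm)
  then have "line_at (Arg b) \<subseteq> L"
    unfolding line_at_conv_span by (simp add: span_minimal sub)
  then have L_eq: "L = line_at (Arg b)"
    using subspace_dim_equal line0_line_at[of "Arg b"] sub dim unfolding line0_def
    by (metis order_refl)
  define \<beta> where "\<beta> = frac ((Arg b - \<theta>) / pi) * pi"
  have "Arg b - (\<theta> + \<beta>) = of_int \<lfloor>(Arg b - \<theta>) / pi\<rfloor> * pi"
    by (simp add: \<beta>_def frac_def field_simps)
  then have "sin (Arg b - (\<theta> + \<beta>)) = 0"
    by (simp add: sin_zero_iff_int2)
  then have "L = line_at (\<theta> + \<beta>)"
    unfolding L_eq line_at_eq_iff .
  moreover have "0 \<le> \<beta>" "\<beta> < pi"
    using frac_lt_1[of "(Arg b - \<theta>) / pi"] by (simp_all add: \<beta>_def)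
  ultimately show thesis
    using that by blast
qed

lemma mem_line_at_add_iff:
  assumes "sin \<beta> \<noteq> 0"
  shows "z \<in> line_at (\<theta> + \<beta>) \<longleftrightarrow> Re (rot (- \<theta>) z) = cot \<beta> * Im (rot (- \<theta>) z)"
proof -
  have "rot (- (\<theta> + \<beta>)) z = rot (- \<beta>) (rot (- \<theta>) z)"
    by (simp add: rot_rot add.commute)
  also have "Im \<dots> = cos \<beta> * Im (rot (- \<theta>) z) - sin \<beta> * Re (rot (- \<theta>) z)"
    by (simp add: rot_def[of "- \<beta>"])
  finally show ?thesis
    using assms by (auto simp: line_at_def cot_def field_simps)
qed

lemma line0_Int_eq_0:
  assumes "line0 L" "line0 M" "L \<noteq> M"
  shows "L \<inter> M = {0}"
proof -
  have sub: "subspace L" "subspace M" "subspace (L \<inter> M)" and dim: "dim L = 1" "dim M = 1"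
    using assms by (auto simp: line0_def subspace_inter)
  have "dim (L \<inter> M) \<noteq> 1"
    using subspace_dim_equal[OF sub(3,1)] subspace_dim_equal[OF sub(3,2)] dim \<open>L \<noteq> M\<close> by auto
  then have "dim (L \<inter> M) = 0"
    using dim_subset[OF Int_lower1[of L M]] dim by linarith
  then show ?thesis
    using subspace_0[OF sub(3)] by auto
qed

lemma line0_sum:
  assumes "line0 L" "line0 M" "L \<noteq> M"
  obtains x y where "x \<in> L" "y \<in> M" "z = x + y"
proof -
  let ?S = "{x + y | x y. x \<in> L \<and> y \<in> M}"
  have sub: "subspace L" "subspace M" and dim: "dim L = 1" "dim M = 1"
    using assms by (auto simp: line0_def)
  have "dim ?S = DIM(complex)"
    using dim_sums_Int[OF sub] dim line0_Int_eq_0[OF assms] by simp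
  then have "?S = UNIV"
    using dim_eq_full[of ?S] span_eq_iff[of ?S] subspace_sums[OF sub] by simp
  then show thesis
    using that by blast
qed

lemma mem_translation_iff: "z \<in> (\<lambda>x. c + x) ` L \<longleftrightarrow> z - c \<in> L" for c :: "'a::ab_group_add"
  by (auto simp: image_iff intro: bexI[of _ "z - c"])

lemma ex1_translated_line0_Int:
  assumes "line0 L" "line0 M" "L \<noteq> M"
  shows "\<exists>!v. v \<in> (\<lambda>x. a + x) ` L \<inter> (\<lambda>x. b + x) ` M"
proof -
  have sub: "subspace L" "subspace M"
    using assms by (auto simp: line0_def)
  obtain x y where mem: "x \<in> L" "y \<in> M" and diff_eq: "b - a = x + y"
    using line0_sum[OF assms] .
  show ?thesis
    unfolding Int_iff mem_translation_iff
  proof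
    have "a + x - b = - y"
      using diff_eq by (simp add: algebra_simps)
    then show "a + x - a \<in> L \<and> a + x - b \<in> M"
      using mem subspace_neg[OF sub(2)] by simp
    fix v assume "v - a \<in> L \<and> v - b \<in> M"
    then have "v - a - x \<in> L" "v - b + y \<in> M"
      using mem subspace_diff[OF sub(1)] subspace_add[OF sub(2)] by blast+
    moreover have "v - b + y = v - a - x"
      using diff_eq by (simp add: algebra_simps)
    ultimately have "v - a - x = 0"
      using line0_Int_eq_0[OF assms] by (metis IntI singletonD)
    then show "v = a + x"
      by (simp add: algebra_simps)
  qed
qed

section \<open>The total turn\<close>

lemma line_angle_line_at:
  assumes "0 < \<theta>' - \<theta>" "\<theta>' - \<theta> \<le> pi"
  shows "line_angle (line_at \<theta>) (line_at \<theta>') = \<theta>' - \<theta>"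
  unfolding line_angle_def
proof (rule cInf_eq_minimum)
  show "\<theta>' - \<theta> \<in> {\<phi>. \<phi> > 0 \<and> rot \<phi> ` line_at \<theta> = line_at \<theta>'}"
    using assms by (simp add: rot_image_line_at)
  fix \<phi> assume "\<phi> \<in> {\<phi>. \<phi> > 0 \<and> rot \<phi> ` line_at \<theta> = line_at \<theta>'}"
  then have "\<phi> > 0" and sin: "sin (\<theta>' - (\<theta> + \<phi>)) = 0"
    unfolding rot_image_line_at mem_Collect_eq by (auto simp flip: line_at_eq_iff)
  show "\<theta>' - \<theta> \<le> \<phi>"
  proof (rule ccontr)
    assume "\<not> \<theta>' - \<theta> \<le> \<phi>"
    then have "sin (\<theta>' - (\<theta> + \<phi>)) > 0"
      using \<open>\<phi> > 0\<close> assms by (intro sin_gt_zero) auto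
    then show False
      using sin by simp
  qed
qed

lemma line_angle_line_at_add:
  assumes "0 \<le> a" "a < pi" "0 \<le> b" "b < pi" "a \<noteq> b"
  shows "line_angle (line_at (\<theta> + a)) (line_at (\<theta> + b)) = b - a + (if b < a then pi else 0)"
proof (cases "b < a")
  case True
  have "line_at (\<theta> + b) = line_at (\<theta> + b + pi)"
    by (simp add: line_at_eq_iff)
  then show ?thesis
    using line_angle_line_at[of "\<theta> + b + pi" "\<theta> + a"] assms True by simp
next
  case False
  then show ?thesis
    using line_angle_line_at[of "\<theta> + b" "\<theta> + a"] assms by simp
qed

lemma sum_cyclic_shift:
  fixes h :: "nat \<Rightarrow> 'a::comm_monoid_add"
  shows "(\<Sum>i<n. h ((i + 1) mod n)) = (\<Sum>i<n. h i)"
proof (cases n)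
  case (Suc m)
  have "(\<Sum>i<m. h ((i + 1) mod n)) = (\<Sum>i<m. h (Suc i))"
    by (rule sum.cong) (auto simp: Suc)
  then have "(\<Sum>i<n. h ((i + 1) mod n)) = (\<Sum>i<m. h (Suc i)) + h 0"
    by (simp add: Suc)
  also have "\<dots> = (\<Sum>i<n. h i)"
    by (simp add: Suc sum.lessThan_Suc_shift add.commute del: sum.lessThan_Suc)
  finally show ?thesis .
qed simp

lemma total_turn_line_at:
  assumes s: "\<And>i. i < n \<Longrightarrow> s i = line_at (\<theta> + \<beta> i)"
    and \<beta>: "\<And>i. i < n \<Longrightarrow> 0 \<le> \<beta> i \<and> \<beta> i < pi"
    and neq: "\<And>i. i < n \<Longrightarrow> \<beta> ((i + 1) mod n) \<noteq> \<beta> i"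
  shows "total_turn n s = real (card {i \<in> {..<n}. \<beta> ((i + 1) mod n) < \<beta> i}) * pi"
proof -
  have "line_angle (s i) (s ((i + 1) mod n)) =
      \<beta> ((i + 1) mod n) - \<beta> i + (if \<beta> ((i + 1) mod n) < \<beta> i then pi else 0)" if "i < n" for i
  proof -
    have "(i + 1) mod n < n"
      using that by simp
    then show ?thesis
      using s[OF that] s[of "(i + 1) mod n"] \<beta>[OF that] \<beta>[of "(i + 1) mod n"] neq[OF that]
      by (simp only: line_angle_line_at_add)
  qed
  then have "total_turn n s = (\<Sum>i<n. \<beta> ((i + 1) mod n) - \<beta> i)
      + (\<Sum>i<n. if \<beta> ((i + 1) mod n) < \<beta> i then pi else 0)"
    by (simp add: total_turn_def sum.distrib del: add_Suc_right)
  also have "(\<Sum>i<n. \<beta> ((i + 1) mod n) - \<beta> i) = 0"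
    using sum_cyclic_shift[of \<beta> n] by (simp add: sum_subtractf)
  also have "(\<Sum>i<n. if \<beta> ((i + 1) mod n) < \<beta> i then pi else 0) =
      real (card {i \<in> {..<n}. \<beta> ((i + 1) mod n) < \<beta> i}) * pi"
    by (simp add: sum.If_cases Int_def)
  finally show ?thesis
    by simp
qed

section \<open>Polygons and their oriented area\<close>

definition parallel_sides :: "nat \<Rightarrow> (nat \<Rightarrow> complex set) \<Rightarrow> (nat \<Rightarrow> complex set) \<Rightarrow> bool" where
  "parallel_sides n s e \<longleftrightarrow> (\<forall>i<n. \<exists>a. e i = (\<lambda>x. a + x) ` s i)"

lemma parallel_sidesE:
  assumes "parallel_sides n s e" "i < n"
  obtains a where "e i = (\<lambda>x. a + x) ` s i"
  using assms unfolding parallel_sides_def by blast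

locale line_cycle =
  fixes n :: nat and s :: "nat \<Rightarrow> complex set"
  assumes line0_side: "i < n \<Longrightarrow> line0 (s i)"
    and consecutive_neq: "i < n \<Longrightarrow> s i \<noteq> s ((i + 1) mod n)"
begin

lemma subspace_side: "i < n \<Longrightarrow> subspace (s i)"
  using line0_side by (simp add: line0_def)

lemma polygon_of_eq_iff:
  assumes e: "parallel_sides n s e"
  shows "v = polygon_of n e \<longleftrightarrow>
    v \<in> extensional {..<n} \<and> (\<forall>i<n. v i \<in> e i \<inter> e ((i + 1) mod n))"
proof -
  have "\<exists>!w. w \<in> e i \<inter> e ((i + 1) mod n)" if "i < n" for i
  proof -
    have next_less: "(i + 1) mod n < n"
      using that by simp
    obtain a where "e i = (\<lambda>x. a + x) ` s i"
      using parallel_sidesE[OF e \<open>i < n\<close>] .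
    moreover obtain b where "e ((i + 1) mod n) = (\<lambda>x. b + x) ` s ((i + 1) mod n)"
      using parallel_sidesE[OF e next_less] .
    ultimately show ?thesis
      using ex1_translated_line0_Int[OF line0_side[OF that] line0_side[OF next_less]
          consecutive_neq[OF that]] by simp
  qed
  then have "(THE w. w \<in> e i \<inter> e ((i + 1) mod n)) = v i \<longleftrightarrow> v i \<in> e i \<inter> e ((i + 1) mod n)"
    if "i < n" for i
    using that by (metis (no_types, lifting) theI')
  then show ?thesis
    unfolding polygon_of_def fun_eq_iff extensional_def restrict_def by (auto; metis)
qed

lemma polygons_iff:
  "v \<in> polygons n s \<longleftrightarrow>
    v \<in> extensional {..<n} \<and> (\<forall>i<n. v ((i + 1) mod n) - v i \<in> s ((i + 1) mod n))"
proof -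
  have "v \<in> polygons n s \<longleftrightarrow> (\<exists>e. parallel_sides n s e \<and> v = polygon_of n e)"
    unfolding polygons_def parallel_sides_def by blast
  also have "\<dots> \<longleftrightarrow> v \<in> extensional {..<n} \<and>
      (\<exists>e. parallel_sides n s e \<and> (\<forall>i<n. v i \<in> e i \<inter> e ((i + 1) mod n)))"
    using polygon_of_eq_iff by blast
  also have "(\<exists>e. parallel_sides n s e \<and> (\<forall>i<n. v i \<in> e i \<inter> e ((i + 1) mod n))) \<longleftrightarrow>
      (\<forall>i<n. v ((i + 1) mod n) - v i \<in> s ((i + 1) mod n))"
  proof (intro iffI allI impI)
    fix i assume "\<exists>e. parallel_sides n s e \<and> (\<forall>i<n. v i \<in> e i \<inter> e ((i + 1) mod n))"
      and i_less: "i < n"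
    then obtain e where e: "parallel_sides n s e" and v: "\<And>i. i < n \<Longrightarrow> v i \<in> e i \<inter> e ((i + 1) mod n)"
      by blast
    have next_less: "(i + 1) mod n < n"
      using i_less by simp
    obtain b where "e ((i + 1) mod n) = (\<lambda>x. b + x) ` s ((i + 1) mod n)"
      using parallel_sidesE[OF e next_less] .
    then have "v i - b \<in> s ((i + 1) mod n)" "v ((i + 1) mod n) - b \<in> s ((i + 1) mod n)"
      using v[OF i_less] v[OF next_less] by (simp_all add: mem_translation_iff)
    from subspace_diff[OF subspace_side[OF next_less] this(2,1)]
    show "v ((i + 1) mod n) - v i \<in> s ((i + 1) mod n)"
      by simp
  next
    assume v: "\<forall>i<n. v ((i + 1) mod n) - v i \<in> s ((i + 1) mod n)"
    have "v i \<in> (\<lambda>x. v i + x) ` s i \<inter> (\<lambda>x. v ((i + 1) mod n) + x) ` s ((i + 1) mod n)" if "i < n" for i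
    proof -
      have "(i + 1) mod n < n"
        using that by simp
      then have "v i - v ((i + 1) mod n) \<in> s ((i + 1) mod n)"
        using v that subspace_neg[OF subspace_side] by (metis minus_diff_eq)
      then show ?thesis
        using subspace_0[OF subspace_side[OF that]] by (simp add: mem_translation_iff)
    qed
    then show "\<exists>e. parallel_sides n s e \<and> (\<forall>i<n. v i \<in> e i \<inter> e ((i + 1) mod n))"
      by (intro exI[of _ "\<lambda>i. (\<lambda>x. v i + x) ` s i"]) (auto simp: parallel_sides_def)
  qed
  finally show ?thesis .
qed

lemma topspace_polygon_top: "topspace (polygon_top n s) = polygons n s"
  unfolding polygon_top_def using polygons_iff by (auto simp: PiE_def)

end

lemma oriented_area_conv_cnj:
  "oriented_area n v = (\<Sum>i<n. Im (cnj (v i) * v ((i + 1) mod n))) / 2"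
  by (simp add: oriented_area_def algebra_simps)

lemma oriented_area_translation: "oriented_area n (\<lambda>i. v i + c) = oriented_area n v"
proof -
  have "Im (cnj (z + c) * (w + c)) = Im (cnj z * w) + (Im (cnj c * w) - Im (cnj c * z))" for z w
    by (simp add: algebra_simps)
  then show ?thesis
    using sum_cyclic_shift[of "\<lambda>i. Im (cnj c * v i)" n]
    unfolding oriented_area_conv_cnj by (simp only: sum.distrib sum_subtractf diff_self add_0_right)
qed

lemma oriented_area_rot: "oriented_area n (\<lambda>i. rot \<phi> (v i)) = oriented_area n v"
proof -
  have "cnj (rot \<phi> z) * rot \<phi> w = cnj z * w" for z w
    by (simp add: rot_def cis_cnj cis_mult mult.assoc mult.left_commute[of _ "cis \<phi>"])
  then show ?thesis
    by (simp only: oriented_area_conv_cnj)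
qed

text \<open>Summation by parts. The inverse slope equation \<open>\<Delta>x = c * \<Delta>y\<close> of each side is multiplied by the
  sum of the two heights, so that a side on the real axis satisfies it for every \<open>c\<close>.\<close>

lemma oriented_area_diag_form:
  assumes "\<And>i. i < n \<Longrightarrow> (Re (v ((i + 1) mod n)) - Re (v i)) * (Im (v i) + Im (v ((i + 1) mod n))) =
    c ((i + 1) mod n) * (Im (v ((i + 1) mod n)) ^ 2 - Im (v i) ^ 2)"
  shows "oriented_area n v = diag_form (\<lambda>i. (c ((i + 1) mod n) - c i) / 2) {..<n} (\<lambda>i. Im (v i))"
proof -
  define x y where "x i = Re (v i)" and "y i = Im (v i)" for i
  have "x i * y ((i + 1) mod n) - x ((i + 1) mod n) * y i =
      (x ((i + 1) mod n) * y ((i + 1) mod n) - x i * y i)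
      - (c ((i + 1) mod n) * y ((i + 1) mod n) ^ 2 - c ((i + 1) mod n) * y i ^ 2)" if "i < n" for i
  proof -
    have "x i * y ((i + 1) mod n) - x ((i + 1) mod n) * y i =
      (x ((i + 1) mod n) * y ((i + 1) mod n) - x i * y i)
      - (x ((i + 1) mod n) - x i) * (y i + y ((i + 1) mod n))"
      by (simp add: algebra_simps)
    then show ?thesis
      using assms[OF that] unfolding x_def y_def by (simp only: right_diff_distrib)
  qed
  then have "2 * oriented_area n v =
      (\<Sum>i<n. x ((i + 1) mod n) * y ((i + 1) mod n)) - (\<Sum>i<n. x i * y i)
      - ((\<Sum>i<n. c ((i + 1) mod n) * y ((i + 1) mod n) ^ 2) - (\<Sum>i<n. c ((i + 1) mod n) * y i ^ 2))"
    by (simp add: oriented_area_def x_def y_def flip: sum_subtractf)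
  also have "\<dots> = (\<Sum>i<n. c ((i + 1) mod n) * y i ^ 2) - (\<Sum>i<n. c i * y i ^ 2)"
    by (simp only: sum_cyclic_shift[of "\<lambda>i. x i * y i"] sum_cyclic_shift[of "\<lambda>i. c i * y i ^ 2"])
  also have "\<dots> = (\<Sum>i<n. (c ((i + 1) mod n) - c i) * y i ^ 2)"
    by (simp only: left_diff_distrib sum_subtractf)
  finally show ?thesis
    by (simp add: diag_form_def y_def flip: sum_divide_distrib)
qed

section \<open>Polygons in height coordinates\<close>

lemma cot_less_cot_iff:
  fixes a b :: real
  assumes "0 < a" "a < pi" "0 < b" "b < pi"
  shows "cot a < cot b \<longleftrightarrow> b < a"
proof -
  have "sin a > 0" "sin b > 0"
    using assms by (auto intro: sin_gt_zero)
  then have "cot a < cot b \<longleftrightarrow> 0 < sin (a - b)"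
    by (simp add: cot_def sin_diff field_simps)
  also have "\<dots> \<longleftrightarrow> b < a"
    using sin_gt_zero[of "a - b"] sin_ge_zero[of "b - a"] sin_minus[of "a - b"] assms
    by (cases "b < a") auto
  finally show ?thesis .
qed

lemma continuous_map_Complex [continuous_intros]:
  "continuous_map X euclideanreal f \<Longrightarrow> continuous_map X euclideanreal g \<Longrightarrow>
    continuous_map X euclidean (\<lambda>x. Complex (f x) (g x))"
  by (simp add: continuous_map_atin tendsto_Complex)

lemma continuous_map_Im [continuous_intros]:
  "continuous_map X euclidean f \<Longrightarrow> continuous_map X euclideanreal (\<lambda>x. Im (f x))"
  by (simp add: continuous_map_atin tendsto_Im)

lemma continuous_map_rot [continuous_intros]:
  "continuous_map X euclidean f \<Longrightarrow> continuous_map X euclidean (\<lambda>x. rot \<phi> (f x))"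
  by (simp add: continuous_map_atin rot_def tendsto_mult_left)

locale line_config =
  fixes n :: nat and s :: "nat \<Rightarrow> complex set" and \<theta> :: real and \<beta> :: "nat \<Rightarrow> real"
  assumes two_le_n: "2 \<le> n"
    and s_eq: "i < n \<Longrightarrow> s i = line_at (\<theta> + \<beta> i)"
    and \<beta>_0: "\<beta> 0 = 0"
    and \<beta>_pos: "0 < i \<Longrightarrow> i < n \<Longrightarrow> 0 < \<beta> i"
    and \<beta>_less_pi: "i < n \<Longrightarrow> \<beta> i < pi"
    and \<beta>_neq: "i < n \<Longrightarrow> \<beta> ((i + 1) mod n) \<noteq> \<beta> i"
begin

lemma \<beta>_nonneg: "i < n \<Longrightarrow> 0 \<le> \<beta> i"
  using \<beta>_0 \<beta>_pos[of i] by (cases "i = 0") auto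

sublocale line_cycle n s
proof
  fix i assume i_less: "i < n"
  then show "line0 (s i)"
    by (simp add: s_eq line0_line_at)
  have next_less: "(i + 1) mod n < n"
    using i_less by simp
  show "s i \<noteq> s ((i + 1) mod n)"
    unfolding s_eq[OF i_less] s_eq[OF next_less]
    using line_at_add_eq_iff \<beta>_nonneg \<beta>_less_pi \<beta>_neq[OF i_less] i_less next_less by metis
qed

lemma sin_\<beta>: "0 < i \<Longrightarrow> i < n \<Longrightarrow> sin (\<beta> i) \<noteq> 0"
  using \<beta>_pos[of i] \<beta>_less_pi[of i] sin_gt_zero[of "\<beta> i"] by auto

definition normal_form :: "(nat \<Rightarrow> complex) \<Rightarrow> nat \<Rightarrow> complex" where
  "normal_form v i = rot (- \<theta>) (v i - v 0)"

lemma normal_form_0 [simp]: "normal_form v 0 = 0"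
  by (simp add: normal_form_def)

lemma normal_form_side:
  assumes "v \<in> polygons n s" "Suc i < n"
  shows "Re (normal_form v (Suc i)) - Re (normal_form v i) =
    cot (\<beta> (Suc i)) * (Im (normal_form v (Suc i)) - Im (normal_form v i))"
proof -
  have "v ((i + 1) mod n) - v i \<in> s ((i + 1) mod n)"
    using assms unfolding polygons_iff by (meson Suc_lessD)
  then have "v (Suc i) - v i \<in> line_at (\<theta> + \<beta> (Suc i))"
    using \<open>Suc i < n\<close> by (simp add: s_eq)
  moreover have "rot (- \<theta>) (v (Suc i) - v i) = normal_form v (Suc i) - normal_form v i"
    by (simp add: normal_form_def rot_diff)
  ultimately show ?thesis
    using sin_\<beta>[of "Suc i"] \<open>Suc i < n\<close> by (simp add: mem_line_at_add_iff)
qed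

lemma Im_normal_form_last:
  assumes "v \<in> polygons n s"
  shows "Im (normal_form v (n - 1)) = 0"
proof -
  have "v ((n - 1 + 1) mod n) - v (n - 1) \<in> s ((n - 1 + 1) mod n)"
    using assms two_le_n unfolding polygons_iff
    by (meson diff_less less_le_trans zero_less_numeral zero_less_one)
  then have "v 0 - v (n - 1) \<in> line_at \<theta>"
    using two_le_n by (simp add: s_eq \<beta>_0)
  then show ?thesis
    by (simp add: line_at_def normal_form_def rot_diff)
qed

lemma normal_form_side_cyclic:
  assumes v: "v \<in> polygons n s" and "i < n"
  shows "(Re (normal_form v ((i + 1) mod n)) - Re (normal_form v i)) *
      (Im (normal_form v i) + Im (normal_form v ((i + 1) mod n))) =
    cot (\<beta> ((i + 1) mod n)) * (Im (normal_form v ((i + 1) mod n)) ^ 2 - Im (normal_form v i) ^ 2)"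
proof (cases "Suc i < n")
  case True
  then show ?thesis
    by (simp add: normal_form_side[OF v True] power2_eq_square algebra_simps)
next
  case False
  with \<open>i < n\<close> have "Suc i = n"
    by simp
  then have "(i + 1) mod n = 0" "Im (normal_form v i) = 0"
    using Im_normal_form_last[OF v] by auto
  then show ?thesis
    by simp
qed

definition heights :: "(nat \<Rightarrow> complex) \<Rightarrow> nat \<Rightarrow> real" where
  "heights v = (\<lambda>i\<in>{1..<n-1}. Im (normal_form v i))"

text \<open>Both end points of the side on the first line, \<open>v (n - 1)\<close> and \<open>v 0\<close>, have height 0.\<close>

definition padded :: "(nat \<Rightarrow> real) \<Rightarrow> nat \<Rightarrow> real" where
  "padded y i = (if i \<in> {1..<n-1} then y i else 0)"

definition offset :: "(nat \<Rightarrow> real) \<Rightarrow> nat \<Rightarrow> real" where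
  "offset y i = (\<Sum>j<i. cot (\<beta> (Suc j)) * (padded y (Suc j) - padded y j))"

definition of_heights :: "(nat \<Rightarrow> real) \<Rightarrow> nat \<Rightarrow> complex" where
  "of_heights y = (\<lambda>i\<in>{..<n}. rot \<theta> (Complex (offset y i) (padded y i)))"

lemma normal_form_of_heights:
  assumes "i < n"
  shows "normal_form (of_heights y) i = Complex (offset y i) (padded y i)"
proof -
  have "of_heights y 0 = 0"
    using two_le_n by (simp add: of_heights_def offset_def padded_def flip: zero_complex.code)
  then show ?thesis
    using assms by (simp add: normal_form_def of_heights_def)
qed

lemma of_heights_in_polygons: "of_heights y \<in> polygons n s"
  unfolding polygons_iff
proof (intro conjI allI impI)
  show "of_heights y \<in> extensional {..<n}"
    by (simp add: of_heights_def)
  fix i assume i_less: "i < n"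
  show "of_heights y ((i + 1) mod n) - of_heights y i \<in> s ((i + 1) mod n)"
  proof (cases "Suc i < n")
    case True
    have "rot (- \<theta>) (of_heights y (Suc i) - of_heights y i) =
        normal_form (of_heights y) (Suc i) - normal_form (of_heights y) i"
      by (simp add: normal_form_def rot_diff)
    then have "of_heights y (Suc i) - of_heights y i \<in> line_at (\<theta> + \<beta> (Suc i))"
      unfolding mem_line_at_add_iff[OF sin_\<beta>[OF zero_less_Suc True]]
      by (simp add: normal_form_of_heights i_less True offset_def)
    then show ?thesis
      using True by (simp add: s_eq)
  next
    case False
    then have last: "i = n - 1" "Suc i = n"
      using i_less by simp_all
    have "rot (- \<theta>) (of_heights y 0 - of_heights y i) = - normal_form (of_heights y) i"
      by (simp add: normal_form_def rot_diff)
    then show ?thesis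
      using i_less two_le_n
      by (simp add: last(2) s_eq \<beta>_0 line_at_def normal_form_of_heights padded_def) (simp add: last)
  qed
qed

lemma heights_of_heights: "y \<in> extensional {1..<n-1} \<Longrightarrow> heights (of_heights y) = y"
  by (auto simp: heights_def normal_form_of_heights padded_def extensional_def fun_eq_iff)

lemma padded_heights:
  assumes "v \<in> polygons n s" "i < n"
  shows "padded (heights v) i = Im (normal_form v i)"
proof -
  consider "i = 0" | "i \<in> {1..<n-1}" | "i = n - 1"
    using assms(2) by force
  then show ?thesis
    using Im_normal_form_last[OF assms(1)] by cases (simp_all add: padded_def heights_def)
qed

lemma offset_heights:
  assumes v: "v \<in> polygons n s" and "i < n"
  shows "offset (heights v) i = Re (normal_form v i)"
  using \<open>i < n\<close>
proof (induction i)
  case 0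
  then show ?case
    by (simp add: offset_def)
next
  case (Suc i)
  have "offset (heights v) (Suc i) = offset (heights v) i +
      cot (\<beta> (Suc i)) * (padded (heights v) (Suc i) - padded (heights v) i)"
    by (simp add: offset_def)
  then show ?case
    using Suc normal_form_side[OF v Suc.prems] by (simp add: padded_heights[OF v])
qed

lemma of_heights_heights:
  assumes "v \<in> polygons n s" "i < n"
  shows "of_heights (heights v) i = v i - v 0"
  using assms by (simp add: of_heights_def padded_heights offset_heights normal_form_def)

lemma transl_equiv_iff_heights:
  assumes v: "v \<in> polygons n s" and w: "w \<in> polygons n s"
  shows "transl_equiv n v w \<longleftrightarrow> heights v = heights w"
proof
  assume "transl_equiv n v w"
  then obtain c where "\<And>i. i < n \<Longrightarrow> w i = v i + c"
    unfolding transl_equiv_def by blast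
  then show "heights v = heights w"
    using two_le_n by (auto simp: heights_def normal_form_def fun_eq_iff)
next
  assume eq: "heights v = heights w"
  have "w i = v i + (w 0 - v 0)" if "i < n" for i
    using of_heights_heights[OF v that] of_heights_heights[OF w that] eq
    by (simp add: algebra_simps)
  then show "transl_equiv n v w"
    unfolding transl_equiv_def by blast
qed

lemma continuous_map_heights:
  "continuous_map (polygon_top n s) (powertop_real {1..<n-1}) heights"
  unfolding continuous_map_componentwise
proof (intro conjI ballI)
  show "heights ` topspace (polygon_top n s) \<subseteq> extensional {1..<n-1}"
    by (auto simp: heights_def)
  fix i assume i_mem: "i \<in> {1..<n-1}"
  have "continuous_map (polygon_top n s) euclidean (\<lambda>v. v j)" if "j < n" for j
    unfolding polygon_top_def
    by (intro continuous_map_from_subtopology continuous_map_product_projection) (use that in simp)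
  then have "continuous_map (polygon_top n s) euclideanreal (\<lambda>v. Im (normal_form v i))"
    unfolding normal_form_def using i_mem by (intro continuous_intros continuous_map_diff) auto
  then show "continuous_map (polygon_top n s) euclideanreal (\<lambda>v. heights v i)"
    using i_mem by (simp add: heights_def)
qed

lemma continuous_map_of_heights:
  "continuous_map (powertop_real {1..<n-1}) (polygon_top n s) of_heights"
  unfolding polygon_top_def
proof (rule continuous_map_into_subtopology)
  let ?E = "powertop_real {1..<n-1}"
  have padded: "continuous_map ?E euclideanreal (\<lambda>y. padded y i)" for i
    unfolding padded_def by (cases "i \<in> {1..<n-1}") (auto intro: continuous_map_product_projection)
  then have "continuous_map ?E euclideanreal (\<lambda>y. offset y i)" for i
    unfolding offset_def
    by (intro continuous_map_sum continuous_map_real_mult continuous_map_diff) auto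
  then have "continuous_map ?E euclidean (\<lambda>y. rot \<theta> (Complex (offset y i) (padded y i)))" for i
    by (intro continuous_intros padded)
  then show "continuous_map ?E (product_topology (\<lambda>_. euclidean) {..<n}) of_heights"
    by (auto simp: continuous_map_componentwise of_heights_def)
qed (use of_heights_in_polygons in auto)

lemma quotient_map_heights: "quotient_map (polygon_top n s) (powertop_real {1..<n-1}) heights"
proof (rule retraction_imp_quotient_map)
  have "heights (of_heights y) = y" if "y \<in> topspace (powertop_real {1..<n-1})" for y
    using that by (intro heights_of_heights) (auto simp: PiE_def)
  then show "retraction_map (polygon_top n s) (powertop_real {1..<n-1}) heights"
    unfolding retraction_map_def retraction_maps_def
    using continuous_map_heights continuous_map_of_heights by blast
qed

text \<open>Meaningful only for \<open>i \<in> {1..<n-1}\<close>: the two other weights involve the junk value \<open>cot 0 = 0\<close>.\<close>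

definition weight :: "nat \<Rightarrow> real" where
  "weight i = (cot (\<beta> ((i + 1) mod n)) - cot (\<beta> i)) / 2"

lemma oriented_area_heights:
  assumes v: "v \<in> polygons n s"
  shows "oriented_area n v = diag_form weight {1..<n-1} (heights v)"
proof -
  have "oriented_area n v = oriented_area n (normal_form v)"
    using oriented_area_rot[of n "- \<theta>" "\<lambda>i. v i + - v 0"] oriented_area_translation[of n v "- v 0"]
    by (simp add: normal_form_def[abs_def])
  also have "\<dots> = diag_form weight {..<n} (\<lambda>i. Im (normal_form v i))"
    unfolding weight_def[abs_def]
    by (rule oriented_area_diag_form) (rule normal_form_side_cyclic[OF v])
  also have "\<dots> = diag_form weight {1..<n-1} (heights v)"
    unfolding diag_form_def
  proof (rule sum.mono_neutral_cong_right)
    have "i = 0 \<or> i = n - 1" if "i \<in> {..<n} - {1..<n-1}" for i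
      using that by auto
    then show "\<forall>i\<in>{..<n} - {1..<n-1}. weight i * (Im (normal_form v i))\<^sup>2 = 0"
      using Im_normal_form_last[OF v] by force
  qed (auto simp: heights_def)
  finally show ?thesis .
qed

lemma Stilde_area_homeomorphic_space:
  "subtopology (Stilde n s) {C \<in> topspace (Stilde n s). \<forall>v\<in>C. P (oriented_area n v)}
    homeomorphic_space
    subtopology (powertop_real {1..<n-1}) {y. P (diag_form weight {1..<n-1} y)}"
  unfolding Stilde_def
  by (rule subtopology_quotient_top_homeomorphic_space[OF quotient_map_heights])
    (simp_all add: topspace_polygon_top transl_equiv_iff_heights oriented_area_heights)

lemma weight_pos_iff:
  assumes "i \<in> {1..<n-1}"
  shows "0 < weight i \<longleftrightarrow> \<beta> (Suc i) < \<beta> i"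
proof -
  have "0 < i" "Suc i < n"
    using assms by auto
  then show ?thesis
    using cot_less_cot_iff[of "\<beta> i" "\<beta> (Suc i)"] \<beta>_pos \<beta>_less_pi by (simp add: weight_def)
qed

lemma weight_nonzero:
  assumes "i \<in> {1..<n-1}"
  shows "weight i \<noteq> 0"
proof -
  have i_bounds: "0 < i" "Suc i < n"
    using assms by auto
  then have "\<beta> i < \<beta> (Suc i) \<or> \<beta> (Suc i) < \<beta> i"
    using \<beta>_neq[of i] by auto
  then show ?thesis
    using i_bounds cot_less_cot_iff[of "\<beta> i" "\<beta> (Suc i)"] cot_less_cot_iff[of "\<beta> (Suc i)" "\<beta> i"]
      \<beta>_pos \<beta>_less_pi by (auto simp: weight_def)
qed

definition pos_index :: nat where
  "pos_index = card {i \<in> {1..<n-1}. weight i > 0}"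

definition neg_index :: nat where
  "neg_index = card {i \<in> {1..<n-1}. weight i < 0}"

lemma total_turn_eq: "total_turn n s = real (1 + pos_index) * pi"
proof -
  have "i < n \<and> \<beta> ((i + 1) mod n) < \<beta> i \<longleftrightarrow> i = n - 1 \<or> i \<in> {1..<n-1} \<and> 0 < weight i" for i
  proof -
    consider (first) "i = 0" | (inner) "i \<in> {1..<n-1}" | (last) "i = n - 1" "0 < i" | (beyond) "n \<le> i"
      by force
    then show ?thesis
    proof cases
      case first
      then show ?thesis
        using two_le_n \<beta>_0 \<beta>_pos[of 1] by auto
    next
      case inner
      then have "Suc i < n"
        by auto
      then show ?thesis
        using inner weight_pos_iff[OF inner] by auto
    next
      case last
      then show ?thesis
        using \<beta>_0 \<beta>_pos[of i] by auto
    qed (use two_le_n in auto)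
  qed
  then have "{i \<in> {..<n}. \<beta> ((i + 1) mod n) < \<beta> i} = insert (n - 1) {i \<in> {1..<n-1}. 0 < weight i}"
    by blast
  moreover have "total_turn n s = real (card {i \<in> {..<n}. \<beta> ((i + 1) mod n) < \<beta> i}) * pi"
    by (rule total_turn_line_at[OF s_eq]) (simp_all only: \<beta>_nonneg \<beta>_less_pi \<beta>_neq simp_thms)
  ultimately show ?thesis
    by (simp add: pos_index_def)
qed

lemma pos_index_add_neg_index: "pos_index + neg_index = n - 2"
proof -
  let ?P = "{i \<in> {1..<n-1}. weight i > 0}" and ?N = "{i \<in> {1..<n-1}. weight i < 0}"
  have "pos_index + neg_index = card (?P \<union> ?N)"
    unfolding pos_index_def neg_index_def by (rule card_Un_disjoint[symmetric]) auto
  also have "?P \<union> ?N = {1..<n-1}"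
    using weight_nonzero by fastforce
  finally show ?thesis
    by simp
qed

lemma S_area_one_homeomorphic_space:
  "S_area n s 1 homeomorphic_space prod_topology (sphere_top (int pos_index - 1)) (disc_top neg_index)"
  unfolding S_area_def pos_index_def neg_index_def
  by (rule homeomorphic_space_trans[OF Stilde_area_homeomorphic_space
        diag_form_level_one_homeomorphic_space]) (simp_all add: weight_nonzero)

lemma S_area_minus_one_homeomorphic_space:
  "S_area n s (-1) homeomorphic_space prod_topology (sphere_top (int neg_index - 1)) (disc_top pos_index)"
  unfolding S_area_def pos_index_def neg_index_def
  by (rule homeomorphic_space_trans[OF Stilde_area_homeomorphic_space
        diag_form_level_minus_one_homeomorphic_space]) (simp_all add: weight_nonzero)

lemma S_conf_homeomorphic_space:
  "S_conf n s homeomorphic_space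
    sum_topology (\<lambda>b. if b then prod_topology (sphere_top (int pos_index - 1)) (disc_top neg_index)
                          else prod_topology (sphere_top (int neg_index - 1)) (disc_top pos_index)) UNIV"
  unfolding S_conf_def pos_index_def neg_index_def
  by (rule homeomorphic_space_trans[OF Stilde_area_homeomorphic_space
        diag_form_abs_level_one_homeomorphic_space]) (simp_all add: weight_nonzero)

end

lemma line_config_exists:
  assumes "2 \<le> n" and line0: "\<forall>i<n. line0 (s i)"
    and distinct: "\<forall>i<n. \<forall>j<n. i \<noteq> j \<longrightarrow> s i \<noteq> s j"
  obtains \<theta> \<beta> where "line_config n s \<theta> \<beta>"
proof -
  have "line0 (s 0)"
    using assms by simp
  then obtain \<theta> where \<theta>: "s 0 = line_at \<theta>"
    using line0_eq_line_at[of "s 0" 0] by auto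
  have "\<exists>b. 0 \<le> b \<and> b < pi \<and> s i = line_at (\<theta> + b)" if "i < n" for i
    using line0_eq_line_at line0 that by metis
  then obtain \<beta> where \<beta>: "\<And>i. i < n \<Longrightarrow> 0 \<le> \<beta> i \<and> \<beta> i < pi \<and> s i = line_at (\<theta> + \<beta> i)"
    by metis
  then have inj: "\<beta> i \<noteq> \<beta> j" if "i < n" "j < n" "i \<noteq> j" for i j
    using distinct that by metis
  have "\<beta> 0 = 0"
    using \<theta> \<beta>[of 0] line_at_add_eq_iff[of "\<beta> 0" 0 \<theta>] \<open>2 \<le> n\<close> by simp
  moreover have "0 < \<beta> i" if "0 < i" "i < n" for i
    using inj[of i 0] \<beta>[of i] \<open>\<beta> 0 = 0\<close> that by force
  moreover have "(i + 1) mod n < n \<and> (i + 1) mod n \<noteq> i" if "i < n" for i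
    using \<open>2 \<le> n\<close> that by (cases "Suc i = n") auto
  ultimately have "line_config n s \<theta> \<beta>"
    using \<open>2 \<le> n\<close> \<beta> inj by unfold_locales auto
  then show thesis
    by (rule that)
qed

theorem mainTheorem3:
  fixes n k :: nat and s :: "nat \<Rightarrow> complex set"
  assumes "n \<ge> 3"
    and "\<forall>i<n. line0 (s i)"
    and "\<forall>i<n. \<forall>j<n. i \<noteq> j \<longrightarrow> s i \<noteq> s j"
    and "total_turn n s = real k * pi"
  shows "S_area n s (-1) homeomorphic_space
           prod_topology (sphere_top (int n - int k - 2)) (disc_top (k - 1))
       \<and> S_area n s 1 homeomorphic_space
           prod_topology (sphere_top (int k - 2)) (disc_top (n - k - 1))
       \<and> S_conf n s homeomorphic_space
           sum_topology (\<lambda>b. if b then prod_topology (sphere_top (int k - 2)) (disc_top (n - k - 1))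
                              else prod_topology (sphere_top (int n - int k - 2)) (disc_top (k - 1)))
             UNIV"
proof -
  obtain \<theta> \<beta> where "line_config n s \<theta> \<beta>"
    using line_config_exists[of n s] assms by auto
  then interpret line_config n s \<theta> \<beta> .
  have "real k * pi = real (1 + pos_index) * pi"
    using total_turn_eq assms(4) by simp
  then have "k = 1 + pos_index"
    by (simp only: mult_cancel_right pi_neq_zero of_nat_eq_iff simp_thms)
  then have dims: "int k - 2 = int pos_index - 1" "k - 1 = pos_index"
    "int n - int k - 2 = int neg_index - 1" "n - k - 1 = neg_index"
    using pos_index_add_neg_index assms(1) by auto
  show ?thesis
    unfolding dims
    using S_area_minus_one_homeomorphic_space S_area_one_homeomorphic_space
      S_conf_homeomorphic_space by blast
qed

end
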